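(* For all positive integers $k$ and $r$, the set $\{k,2k,\ldots,rk\}$ is $r$-Birkhoff but not $(r+1)$-Birkhoff.
   Context: For a positive integer $s$, a set $L\subset\mathbb{Z}\setminus\{0\}$ is $s$-Birkhoff if for every sequence $\{z_i\}_{i\in\mathbb{Z}}$ with values in $\{1,2,\dots,s\}$ there are $m\in L$ and $i\in\mathbb{Z}$ such that $z_i=z_{i+m}$. *)

theory Defs
  imports Main
begin

text \<open>The domain conditions (\<open>s\<close> positive, \<open>L\<close> a set of nonzero integers) are part of the predicate;
  a negated statement therefore only has its intended meaning when both are known to hold.\<close>

definition birkhoff :: "nat \<Rightarrow> int set \<Rightarrow> bool" where
  "birkhoff s L \<longleftrightarrow> s > 0 \<and> L \<subseteq> UNIV - {0} \<and>
     (\<forall>z :: int \<Rightarrow> nat. range z \<subseteq> {1..s} \<longrightarrow> (\<exists>m\<in>L. \<exists>i. z i = z (i + m)))"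

end

theory Submission
  imports Defs
begin

text \<open>Among the r + 1 points 0, k, ..., rk, two share one of the r colours, and their
  difference is again one of k, ..., rk. For r + 1 colours, cut the integers into blocks of length k
  and colour the blocks cyclically: a shift by jk moves each point exactly j blocks on, which
  changes its colour since 0 < j < r + 1.\<close>

theorem mainTheorem6:
  fixes k r :: nat
  assumes "k > 0" and "r > 0"
  shows "birkhoff r {int (j * k) | j. j \<in> {1..r}} \<and>
         \<not> birkhoff (r + 1) {int (j * k) | j. j \<in> {1..r}}"
proof
  let ?L = "{int (j * k) | j. j \<in> {1..r}}"
  have "\<exists>m\<in>?L. \<exists>i. z i = z (i + m)" if z: "range z \<subseteq> {1..r}" for z :: "int \<Rightarrow> nat"
  proof -
    let ?f = "\<lambda>j::nat. z (int (j * k))"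
    have "card (?f ` {0..r}) \<le> card {1..r}"
      using z by (intro card_mono) auto
    then have "\<not> inj_on ?f {0..r}"
      by (intro pigeonhole) simp
    then obtain a b where ab: "a < b" "b \<le> r" "?f a = ?f b"
      by (auto simp: inj_on_def) (metis linorder_neqE_nat)
    have "int (a * k) + int ((b - a) * k) = int (b * k)"
      using ab(1) by (simp add: of_nat_diff algebra_simps)
    then have "z (int (a * k)) = z (int (a * k) + int ((b - a) * k))"
      using ab(3) by simp
    moreover have "int ((b - a) * k) \<in> ?L"
      using ab(1,2) by (intro CollectI exI[of _ "b - a"]) auto
    ultimately show ?thesis
      by blast
  qed
  \<comment> \<open>The domain conditions come from \<open>assms\<close>: \<open>k > 0\<close>
    together with j \<ge> 1 keeps 0 out of \<open>?L\<close>.\<close>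
  then show "birkhoff r ?L"
    using assms by (auto simp: birkhoff_def)

  \<comment> \<open>Floor division numbers the blocks consistently across negative \<open>i\<close>;
    the final \<open>+ 1\<close> turns residues 0..r into colours 1..r + 1.\<close>
  let ?z = "\<lambda>i::int. nat (i div int k mod int (r + 1)) + 1"
  have "?z i \<le> r + 1" for i
    using pos_mod_bound[of "int (r + 1)" "i div int k"] by linarith
  then have range: "range ?z \<subseteq> {1..r + 1}"
    by (intro image_subsetI) simp
  have "?z i \<noteq> ?z (i + int (j * k))" if j: "j \<in> {1..r}" for i and j :: nat
  proof
    assume "?z i = ?z (i + int (j * k))"
    moreover have "(i + int (j * k)) div int k = i div int k + int j"
      using assms(1) by simp
    ultimately have "(i div int k + int j) mod int (r + 1) = i div int k mod int (r + 1)"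
      by (simp add: eq_nat_nat_iff)
    then have "int (r + 1) dvd int j"
      by (metis add_diff_cancel_left' mod_eq_dvd_iff)
    then have "r + 1 dvd j"
      by (simp only: of_nat_dvd_iff)
    then show False
      using j by (auto dest: dvd_imp_le)
  qed
  \<comment> \<open>It is the colouring clause that fails, with \<open>?z\<close> as counterexample;
    the domain conditions hold by the first half.\<close>
  with range show "\<not> birkhoff (r + 1) ?L"
    unfolding birkhoff_def by blast
qed

end
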